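(* Let $\mathfrak{A}$ be a residuated lattice. The following assertions are equivalent: (1) $\mathfrak{A}$ is mp; (2) the identity map $\iota:Spp(\mathfrak{A})\longrightarrow Min_{d}(\mathfrak{A})$ is a homeomorphism (that is, $Spp(\mathfrak{A})=Min(\mathfrak{A})$ as sets and the identity map is a homeomorphism from the pure spectrum onto $Min_{d}(\mathfrak{A})$).
   Context: A residuated lattice is an algebra $\mathfrak{A}=(A;\vee,\wedge,\odot,\rightarrow,0,1)$ such that $(A;\vee,\wedge,0,1)$ is a bounded lattice, $(A;\odot,1)$ is a commutative monoid, and $x\odot y\leq z$ iff $x\leq y\rightarrow z$ for all $x,y,z\in A$. A filter of $\mathfrak{A}$ is a non-empty subset $F\subseteq A$ with $x\odot y\in F$ for all $x,y\in F$, and $x\vee y\in F$ for all $x\in F$, $y\in A$. For filters $F,G$, $F\veebar G$ is the filter generated by $F\cup G$. A prime filter is a proper filter $\mathfrak{p}$ that is meet-irreducible among filters (equivalently, $x\vee y\in\mathfrak{p}$ implies $x\in\mathfrak{p}$ or $y\in\mathfrak{p}$); $Min(\mathfrak{A})$ is the set of inclusion-minimal prime filters. $\mathfrak{A}$ is mp if every prime filter contains a unique minimal prime filter. $Min_{d}(\mathfrak{A})$ is $Min(\mathfrak{A})$ with the dual hull-kernel topology, having the sets $\{\mathfrak{m}\in Min(\mathfrak{A})\mid x\in\mathfrak{m}\}$, $x\in A$, as an open basis. For $a\in A$, $a^{\perp}=\{b\in A\mid b\vee a=1\}$. For a filter $F$, $\sigma(F)$ is the intersection of all prime filters $\mathfrak{q}$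 that are contained in some prime filter containing $F$ (the empty intersection being $A$); equivalently $\sigma(F)=\{a\in A\mid F\veebar a^{\perp}=A\}$. $F$ is pure if $\sigma(F)=F$; $\sigma(\mathfrak{A})$ denotes the set of pure filters. A proper pure filter $\mathfrak{p}$ is purely-prime if for all $F_1,F_2\in\sigma(\mathfrak{A})$, $F_1\cap F_2\subseteq\mathfrak{p}$ implies $F_1\subseteq\mathfrak{p}$ or $F_2\subseteq\mathfrak{p}$. $Spp(\mathfrak{A})$ is the set of purely-prime filters; the pure spectrum is $Spp(\mathfrak{A})$ with the topology whose open sets are $d_{p}(F)=\{P\in Spp(\mathfrak{A})\mid F\nsubseteq P\}$, $F\in\sigma(\mathfrak{A})$. *)

theory Defs
  imports "HOL-Analysis.Abstract_Topology"
begin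

unbundle lattice_syntax

text \<open>
  The lattice bounds are \<open>\<bottom>\<close> and \<open>\<top>\<close>; the monoid \<open>(\<odot>, 1)\<close> is written \<open>(*, 1)\<close>, and
  \<open>one_eq_top\<close> identifies its unit with the top of the lattice. The one-element
  algebra is allowed.
\<close>

class residuated_lattice = bounded_lattice + comm_monoid_mult +
  fixes residuum :: "'a \<Rightarrow> 'a \<Rightarrow> 'a"  (infixr "\<rightharpoonup>" 60)
  assumes one_eq_top: "1 = \<top>"
    and residuation: "x * y \<le> z \<longleftrightarrow> x \<le> y \<rightharpoonup> z"

definition lfilter :: "'a::residuated_lattice set \<Rightarrow> bool" where
  "lfilter F \<longleftrightarrow> F \<noteq> {} \<and> (\<forall>x\<in>F. \<forall>y\<in>F. x * y \<in> F) \<and> (\<forall>x\<in>F. \<forall>y. x \<squnion> y \<in> F)"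

definition prime_lfilter :: "'a::residuated_lattice set \<Rightarrow> bool" where
  "prime_lfilter P \<longleftrightarrow> lfilter P \<and> P \<noteq> UNIV \<and>
     (\<forall>F G. lfilter F \<longrightarrow> lfilter G \<longrightarrow> F \<inter> G = P \<longrightarrow> F = P \<or> G = P)"

definition Min_primes :: "'a::residuated_lattice set set" where
  "Min_primes = {m. prime_lfilter m \<and> (\<forall>q. prime_lfilter q \<longrightarrow> q \<subseteq> m \<longrightarrow> q = m)}"

definition mp :: "'a::residuated_lattice itself \<Rightarrow> bool" where
  "mp _ \<longleftrightarrow> (\<forall>P::'a set. prime_lfilter P \<longrightarrow> (\<exists>!m. m \<in> Min_primes \<and> m \<subseteq> P))"

text \<open>
  The sets \<open>{m \<in> Min_primes. x \<in> m}\<close> are closed under binary intersection (see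
  \<open>Min_d_base_Int\<close> below), so their arbitrary unions form a topology.
\<close>

definition Min_d :: "'a::residuated_lattice set topology" where
  "Min_d = topology (arbitrary union_of (\<lambda>U. \<exists>x. U = {m \<in> Min_primes. x \<in> m}))"

text \<open>If no prime filter qualifies, the intersection is \<open>UNIV\<close>, i.e. the whole algebra.\<close>

definition sigma_part :: "'a::residuated_lattice set \<Rightarrow> 'a set" where
  "sigma_part F =
     \<Inter>{q. prime_lfilter q \<and> (\<exists>p. prime_lfilter p \<and> F \<subseteq> p \<and> q \<subseteq> p)}"

definition pure_lfilter :: "'a::residuated_lattice set \<Rightarrow> bool" where
  "pure_lfilter F \<longleftrightarrow> lfilter F \<and> sigma_part F = F"

definition Spp :: "'a::residuated_lattice set set" where
  "Spp = {P. pure_lfilter P \<and> P \<noteq> UNIV \<and>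
     (\<forall>F G. pure_lfilter F \<longrightarrow> pure_lfilter G \<longrightarrow> F \<inter> G \<subseteq> P \<longrightarrow> F \<subseteq> P \<or> G \<subseteq> P)}"

definition d_p :: "'a::residuated_lattice set \<Rightarrow> 'a set set" where
  "d_p F = {P \<in> Spp. \<not> F \<subseteq> P}"

text \<open>
  Carrier \<open>Spp\<close>; that the sets \<open>d_p F\<close> with \<open>F\<close> pure are exactly the open sets is
  \<open>openin_pure_spectrum\<close> below.
\<close>

definition pure_spectrum :: "'a::residuated_lattice set topology" where
  "pure_spectrum = topology (\<lambda>U. \<exists>F. pure_lfilter F \<and> U = d_p F)"


subsection \<open>Basic facts on filters\<close>

context residuated_lattice
begin

lemma mult_left_mono_rl: "x \<le> y \<Longrightarrow> x * z \<le> y * z"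
  unfolding residuation by (erule order_trans) (simp flip: residuation)

lemma mult_le_left_rl: "x * y \<le> x"
proof -
  have "y * x \<le> 1 * x" by (rule mult_left_mono_rl) (simp add: one_eq_top)
  then show ?thesis by (simp add: mult.commute)
qed

lemma mult_le_right_rl: "x * y \<le> y"
  using mult_le_left_rl[of y x] by (simp add: mult.commute)

lemma sup_mult_rl: "(x \<squnion> y) * z \<le> w \<longleftrightarrow> x * z \<le> w \<and> y * z \<le> w"
  by (simp add: residuation)

lemma sup_mult_sup_le: "(z \<squnion> a) * (w \<squnion> a) \<le> z * w \<squnion> a"
proof -
  have "z * (w \<squnion> a) \<le> z * w \<squnion> a"
    unfolding mult.commute[of z] sup_mult_rl
    using mult_le_left_rl[of a z] by (simp add: le_supI2)
  moreover have "a * (w \<squnion> a) \<le> z * w \<squnion> a"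
    using mult_le_left_rl[of a "w \<squnion> a"] by (simp add: le_supI2)
  ultimately show ?thesis by (simp add: sup_mult_rl)
qed

end

lemma lfilter_up: "lfilter F \<Longrightarrow> x \<in> F \<Longrightarrow> x \<le> y \<Longrightarrow> y \<in> F"
proof -
  assume "lfilter F" "x \<in> F" "x \<le> y"
  then have "x \<squnion> y \<in> F" by (simp add: lfilter_def)
  with \<open>x \<le> y\<close> show "y \<in> F" by (simp add: sup.absorb2)
qed

lemma lfilter_mult: "lfilter F \<Longrightarrow> x \<in> F \<Longrightarrow> y \<in> F \<Longrightarrow> x * y \<in> F"
  by (simp add: lfilter_def)

lemma lfilter_top: "lfilter F \<Longrightarrow> \<top> \<in> F"
proof -
  assume F: "lfilter F"
  then obtain x where "x \<in> F" unfolding lfilter_def by auto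
  then show "\<top> \<in> F" using lfilter_up[OF F _ top_greatest] by simp
qed

lemma lfilterI:
  assumes "\<top> \<in> F" "\<And>x y. x \<in> F \<Longrightarrow> y \<in> F \<Longrightarrow> x * y \<in> F"
    "\<And>x y. x \<in> F \<Longrightarrow> x \<le> y \<Longrightarrow> y \<in> F"
  shows "lfilter F"
  unfolding lfilter_def
proof (intro conjI ballI allI)
  show "F \<noteq> {}" using assms(1) by auto
  show "x * y \<in> F" if "x \<in> F" "y \<in> F" for x y using that by (rule assms(2))
  show "x \<squnion> y \<in> F" if "x \<in> F" for x y using that sup_ge1 by (rule assms(3))
qed

lemma lfilter_Inter: "(\<And>F. F \<in> \<F> \<Longrightarrow> lfilter F) \<Longrightarrow> lfilter (\<Inter>\<F>)"
proof (rule lfilterI)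
  assume F: "\<And>F. F \<in> \<F> \<Longrightarrow> lfilter F"
  show "\<top> \<in> \<Inter>\<F>" using lfilter_top[OF F] by simp
  show "x * y \<in> \<Inter>\<F>" if "x \<in> \<Inter>\<F>" "y \<in> \<Inter>\<F>" for x y
    using that lfilter_mult[OF F] by simp
  show "y \<in> \<Inter>\<F>" if "x \<in> \<Inter>\<F>" "x \<le> y" for x y
    using that lfilter_up[OF F, of _ x y] by simp
qed

lemma lfilter_Int: "lfilter F \<Longrightarrow> lfilter G \<Longrightarrow> lfilter (F \<inter> G)"
  using lfilter_Inter[of "{F, G}"] by auto

lemma lfilter_top_singleton: "lfilter {\<top> :: 'a::residuated_lattice}"
proof (rule lfilterI)
  fix x y :: 'a assume "x \<in> {\<top>}" "y \<in> {\<top>}"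
  then show "x * y \<in> {\<top>}" using mult_1_left[of "1::'a"] by (simp add: one_eq_top)
qed (auto simp: top_unique)

lemma lfilter_quotient:
  fixes F :: "'a::residuated_lattice set"
  assumes "lfilter F"
  shows "lfilter {z. \<forall>w\<in>S. z \<squnion> w \<in> F}"
proof (rule lfilterI)
  show "\<top> \<in> {z. \<forall>w\<in>S. z \<squnion> w \<in> F}"
    using lfilter_top[OF assms] by simp
next
  fix x y assume "x \<in> {z. \<forall>w\<in>S. z \<squnion> w \<in> F}" "y \<in> {z. \<forall>w\<in>S. z \<squnion> w \<in> F}"
  then show "x * y \<in> {z. \<forall>w\<in>S. z \<squnion> w \<in> F}"
    using lfilter_up[OF assms _ sup_mult_sup_le] lfilter_mult[OF assms] by blast
next
  fix x y assume "x \<in> {z. \<forall>w\<in>S. z \<squnion> w \<in> F}" "x \<le> y"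
  then show "y \<in> {z. \<forall>w\<in>S. z \<squnion> w \<in> F}"
    using lfilter_up[OF assms] by (auto intro: sup_mono)
qed

lemma prime_lfilter_iff:
  "prime_lfilter P \<longleftrightarrow>
     lfilter P \<and> P \<noteq> UNIV \<and> (\<forall>x y. x \<squnion> y \<in> P \<longrightarrow> x \<in> P \<or> y \<in> P)"
proof (intro iffI conjI allI impI)
  assume P: "prime_lfilter P"
  then show fP: "lfilter P" and "P \<noteq> UNIV" by (auto simp: prime_lfilter_def)
  fix a b assume ab: "a \<squnion> b \<in> P"
  define F where "F = {z. \<forall>w\<in>{a}. z \<squnion> w \<in> P}"
  define G where "G = {z. \<forall>w\<in>F. z \<squnion> w \<in> P}"
  have fF: "lfilter F" and fG: "lfilter G"
    unfolding F_def G_def by (rule lfilter_quotient[OF fP])+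
  have "P \<subseteq> F" "P \<subseteq> G"
    using fP by (auto simp: F_def G_def lfilter_def)
  moreover have "F \<inter> G \<subseteq> P"
    unfolding G_def by (auto dest: bspec)
  ultimately have "F \<inter> G = P" by blast
  then have "F = P \<or> G = P" using P fF fG unfolding prime_lfilter_def by blast
  moreover have "b \<in> F" using ab by (simp add: F_def sup.commute)
  moreover have "a \<in> G" by (auto simp: F_def G_def sup.commute)
  ultimately show "a \<in> P \<or> b \<in> P" by blast
next
  assume *: "lfilter P \<and> P \<noteq> UNIV \<and> (\<forall>x y. x \<squnion> y \<in> P \<longrightarrow> x \<in> P \<or> y \<in> P)"
  have "F = P \<or> G = P" if F: "lfilter F" and G: "lfilter G" and FG: "F \<inter> G = P" for F G
  proof (rule ccontr)
    assume "\<not> (F = P \<or> G = P)"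
    then obtain a b where "a \<in> F" "a \<notin> P" "b \<in> G" "b \<notin> P" using FG by blast
    moreover from this have "a \<squnion> b \<in> F \<inter> G"
      using lfilter_up[OF F _ sup_ge1] lfilter_up[OF G _ sup_ge2] by blast
    ultimately show False using FG * by blast
  qed
  with * show "prime_lfilter P" unfolding prime_lfilter_def by blast
qed

lemma prime_lfilter_Int_subset:
  assumes "prime_lfilter P" "lfilter F" "lfilter G" "F \<inter> G \<subseteq> P"
  shows "F \<subseteq> P \<or> G \<subseteq> P"
proof (rule ccontr)
  assume "\<not> (F \<subseteq> P \<or> G \<subseteq> P)"
  then obtain a b where "a \<in> F" "a \<notin> P" "b \<in> G" "b \<notin> P" by blast
  moreover from this have "a \<squnion> b \<in> F \<inter> G"
    using lfilter_up[OF assms(2) _ sup_ge1] lfilter_up[OF assms(3) _ sup_ge2] by blast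
  ultimately show False using assms(1,4) unfolding prime_lfilter_iff by blast
qed

lemma prime_lfilter_separation:
  assumes F: "lfilter F" and x: "x \<notin> F"
  obtains P where "prime_lfilter P" "F \<subseteq> P" "x \<notin> P"
proof -
  let ?A = "{G. lfilter G \<and> F \<subseteq> G \<and> x \<notin> G}"
  have "\<exists>M\<in>?A. \<forall>X\<in>?A. M \<subseteq> X \<longrightarrow> X = M"
  proof (rule subset_Zorn_nonempty)
    show "?A \<noteq> {}" using F x by blast
  next
    fix C assume C: "C \<noteq> {}" "subset.chain ?A C"
    then have CA: "C \<subseteq> ?A" and lin: "\<And>X Y. X \<in> C \<Longrightarrow> Y \<in> C \<Longrightarrow> X \<subseteq> Y \<or> Y \<subseteq> X"
      by (auto simp: subset_chain_def)
    obtain X0 where X0: "X0 \<in> C" using C by blast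
    have "lfilter (\<Union>C)"
    proof (rule lfilterI)
      show "\<top> \<in> \<Union>C" using X0 CA lfilter_top by blast
    next
      fix u v assume "u \<in> \<Union>C" "v \<in> \<Union>C"
      then obtain X Y where "X \<in> C" "Y \<in> C" "u \<in> X" "v \<in> Y" by blast
      then obtain Z where "Z \<in> C" "u \<in> Z" "v \<in> Z" using lin by blast
      then show "u * v \<in> \<Union>C" using CA lfilter_mult by blast
    next
      fix u v assume "u \<in> \<Union>C" "u \<le> v"
      then show "v \<in> \<Union>C" using CA lfilter_up by blast
    qed
    then show "\<Union>C \<in> ?A" using CA X0 by blast
  qed
  then obtain M where "M \<in> ?A" and M_max: "\<forall>X\<in>?A. M \<subseteq> X \<longrightarrow> X = M" ..
  then have M: "lfilter M" "F \<subseteq> M" "x \<notin> M" by simp_all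
  have max: "X = M" if "lfilter X" "x \<notin> X" "M \<subseteq> X" for X
    using M_max that M(2) by simp
  have "G = M \<or> H = M" if "lfilter G" "lfilter H" "G \<inter> H = M" for G H
  proof -
    have "x \<notin> G \<or> x \<notin> H" "M \<subseteq> G" "M \<subseteq> H" using that M(3) by auto
    then show ?thesis using max that by metis
  qed
  then have "prime_lfilter M"
    unfolding prime_lfilter_def using M by auto
  then show ?thesis using that M by simp
qed

lemma sigma_part_subset:
  assumes "lfilter F" shows "sigma_part F \<subseteq> F"
proof
  fix x assume x: "x \<in> sigma_part F"
  show "x \<in> F"
  proof (rule ccontr)
    assume "x \<notin> F"
    from prime_lfilter_separation[OF assms this] obtain P
      where P: "prime_lfilter P" "F \<subseteq> P" "x \<notin> P" .
    then have "sigma_part F \<subseteq> P"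
      unfolding sigma_part_def by (intro Inter_lower) auto
    with x P(3) show False by (auto dest: subsetD)
  qed
qed

lemma pure_lfilter_iff:
  "pure_lfilter F \<longleftrightarrow> lfilter F \<and>
     (\<forall>p q. prime_lfilter p \<longrightarrow> prime_lfilter q \<longrightarrow> F \<subseteq> p \<longrightarrow> q \<subseteq> p \<longrightarrow> F \<subseteq> q)"
proof -
  have "F \<subseteq> sigma_part F \<longleftrightarrow>
     (\<forall>p q. prime_lfilter p \<longrightarrow> prime_lfilter q \<longrightarrow> F \<subseteq> p \<longrightarrow> q \<subseteq> p \<longrightarrow> F \<subseteq> q)"
    unfolding sigma_part_def by blast
  then show ?thesis
    unfolding pure_lfilter_def using sigma_part_subset[of F] by blast
qed

lemma pure_lfilter_UNIV: "pure_lfilter UNIV"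
proof -
  have "lfilter UNIV" by (rule lfilterI) simp_all
  then show ?thesis by (auto simp: pure_lfilter_iff prime_lfilter_def)
qed

lemma pure_lfilter_top: "pure_lfilter {\<top>}"
  unfolding pure_lfilter_iff prime_lfilter_def
  by (simp add: lfilter_top_singleton lfilter_top)

lemma pure_lfilter_subset:
  assumes "pure_lfilter F" "prime_lfilter p" "prime_lfilter q" "F \<subseteq> p" "q \<subseteq> p"
  shows "F \<subseteq> q"
  using iffD1[OF pure_lfilter_iff assms(1)] assms(2-) by iprover

lemma pure_lfilter_Int:
  assumes F: "pure_lfilter F" and G: "pure_lfilter G"
  shows "pure_lfilter (F \<inter> G)"
  unfolding pure_lfilter_iff
proof (intro conjI allI impI)
  have *: "lfilter F" "lfilter G" using F G unfolding pure_lfilter_def by iprover+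
  then show "lfilter (F \<inter> G)" by (rule lfilter_Int)
  fix p q assume p: "prime_lfilter p" and q: "prime_lfilter q"
    and sub: "F \<inter> G \<subseteq> p" "q \<subseteq> p"
  from prime_lfilter_Int_subset[OF p * sub(1)] show "F \<inter> G \<subseteq> q"
  proof
    assume "F \<subseteq> p"
    from pure_lfilter_subset[OF F p q this sub(2)] show ?thesis by (rule le_infI1)
  next
    assume "G \<subseteq> p"
    from pure_lfilter_subset[OF G p q this sub(2)] show ?thesis by (rule le_infI2)
  qed
qed

lemma pure_lfilter_join:
  assumes "\<And>F. F \<in> \<F> \<Longrightarrow> pure_lfilter F"
  shows "pure_lfilter (\<Inter>{G. lfilter G \<and> \<Union>\<F> \<subseteq> G})"
  unfolding pure_lfilter_iff
proof (intro conjI allI impI)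
  show "lfilter (\<Inter>{G. lfilter G \<and> \<Union>\<F> \<subseteq> G})" by (rule lfilter_Inter) blast
next
  fix p q assume p: "prime_lfilter p" and q: "prime_lfilter q"
    and sub: "\<Inter>{G. lfilter G \<and> \<Union>\<F> \<subseteq> G} \<subseteq> p" "q \<subseteq> p"
  have "F \<subseteq> q" if "F \<in> \<F>" for F
  proof -
    have "F \<subseteq> p" using sub that by blast
    then show ?thesis using pure_lfilter_subset[OF assms[OF that] p q] sub(2) by iprover
  qed
  moreover have "lfilter q" using q by (simp add: prime_lfilter_def)
  ultimately show "\<Inter>{G. lfilter G \<and> \<Union>\<F> \<subseteq> G} \<subseteq> q" by blast
qed


subsection \<open>The two families of sets are topologies\<close>

lemma Spp_lfilter: "P \<in> Spp \<Longrightarrow> lfilter P"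
  by (simp add: Spp_def pure_lfilter_def)

lemma istopology_d_p: "istopology (\<lambda>U. \<exists>F. pure_lfilter F \<and> U = d_p F)"
  unfolding istopology_def
proof (intro conjI allI impI)
  fix S T :: "'a set set"
  assume "\<exists>F. pure_lfilter F \<and> S = d_p F" "\<exists>F. pure_lfilter F \<and> T = d_p F"
  then obtain F G where FG: "pure_lfilter F" "S = d_p F" "pure_lfilter G" "T = d_p G"
    by blast
  then have "S \<inter> T = d_p (F \<inter> G)" unfolding d_p_def Spp_def by blast
  then show "\<exists>F. pure_lfilter F \<and> S \<inter> T = d_p F"
    using FG pure_lfilter_Int by blast
next
  fix K :: "'a set set set"
  assume "\<forall>U\<in>K. \<exists>F. pure_lfilter F \<and> U = d_p F"
  then obtain f where f: "\<And>U. U \<in> K \<Longrightarrow> pure_lfilter (f U) \<and> U = d_p (f U)" by metis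
  let ?H = "\<Inter>{G. lfilter G \<and> \<Union>(f ` K) \<subseteq> G}"
  have "pure_lfilter ?H" using f by (intro pure_lfilter_join) blast
  moreover have "?H \<subseteq> P \<longleftrightarrow> (\<forall>U\<in>K. f U \<subseteq> P)" if "P \<in> Spp" for P
    using Spp_lfilter[OF that] by blast
  then have "P \<in> d_p ?H \<longleftrightarrow> (\<exists>U\<in>K. P \<in> d_p (f U))" for P
    unfolding d_p_def mem_Collect_eq by metis
  then have "P \<in> d_p ?H \<longleftrightarrow> P \<in> \<Union>K" for P
    unfolding Union_iff using f by metis
  then have "\<Union>K = d_p ?H" by (intro set_eqI) simp
  ultimately show "\<exists>F. pure_lfilter F \<and> \<Union>K = d_p F"
    by (intro exI[of _ ?H] conjI)
qed

lemma openin_pure_spectrum: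
  "openin pure_spectrum U \<longleftrightarrow> (\<exists>F. pure_lfilter F \<and> U = d_p F)"
  unfolding pure_spectrum_def topology_inverse'[OF istopology_d_p] ..

lemma topspace_pure_spectrum [simp]:
  "topspace (pure_spectrum :: 'a::residuated_lattice set topology) = Spp"
proof (rule subset_antisym)
  let ?X = "pure_spectrum :: 'a set topology"
  obtain F where "topspace ?X = d_p F"
    using openin_topspace[of ?X] unfolding openin_pure_spectrum by auto
  then show "topspace ?X \<subseteq> Spp" by (auto simp: d_p_def)
  have "\<not> UNIV \<subseteq> P" if "P \<in> Spp" for P :: "'a set"
    using that unfolding Spp_def by (simp add: top.extremum_unique)
  then have "Spp = d_p (UNIV :: 'a set)" unfolding d_p_def by auto
  then have "openin ?X Spp"
    unfolding openin_pure_spectrum by (intro exI[of _ UNIV] conjI pure_lfilter_UNIV)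
  then show "Spp \<subseteq> topspace ?X" by (rule openin_subset)
qed

lemma Min_primes_lfilter: "m \<in> Min_primes \<Longrightarrow> lfilter m"
  by (simp add: Min_primes_def prime_lfilter_def)

lemma Min_d_base_Int:
  "{m \<in> Min_primes. x \<in> m} \<inter> {m \<in> Min_primes. y \<in> m} = {m \<in> Min_primes. x * y \<in> m}"
proof -
  have "x \<in> m \<and> y \<in> m \<longleftrightarrow> x * y \<in> m" if "m \<in> Min_primes" for m
  proof -
    have m: "lfilter m" by (rule Min_primes_lfilter[OF that])
    show ?thesis
      using lfilter_mult[OF m] lfilter_up[OF m _ mult_le_left_rl[of x y]]
        lfilter_up[OF m _ mult_le_right_rl[of x y]] by iprover
  qed
  then show ?thesis by auto
qed

lemma openin_Min_d:
  "openin (Min_d :: 'a::residuated_lattice set topology) =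
    arbitrary union_of (\<lambda>U. \<exists>x. U = {m \<in> Min_primes. x \<in> m})"
proof -
  have "istopology (arbitrary union_of (\<lambda>U. \<exists>x::'a. U = {m \<in> Min_primes. x \<in> m}))"
  proof (rule istopology_base)
    fix S T :: "'a set set"
    assume "\<exists>x. S = {m \<in> Min_primes. x \<in> m}" "\<exists>x. T = {m \<in> Min_primes. x \<in> m}"
    then obtain x y where
      "S = {m \<in> Min_primes. x \<in> m}" "T = {m \<in> Min_primes. y \<in> m}" by auto
    then show "\<exists>x. S \<inter> T = {m \<in> Min_primes. x \<in> m}"
      by (intro exI[of _ "x * y"]) (simp only: Min_d_base_Int)
  qed
  then show ?thesis unfolding Min_d_def by (rule topology_inverse')
qed

lemma topspace_Min_d [simp]:
  "topspace (Min_d :: 'a::residuated_lattice set topology) = Min_primes"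
proof (rule subset_antisym)
  let ?X = "Min_d :: 'a set topology"
  have "(arbitrary union_of (\<lambda>U. \<exists>x. U = {m \<in> Min_primes. x \<in> m})) (topspace ?X)"
    using openin_topspace[of ?X] unfolding openin_Min_d .
  then show "topspace ?X \<subseteq> Min_primes" unfolding union_of_def by auto
  have *: "(Min_primes :: 'a set set) = {m \<in> Min_primes. \<top> \<in> m}"
    by (auto intro: lfilter_top Min_primes_lfilter)
  have "openin ?X Min_primes"
    unfolding openin_Min_d by (intro arbitrary_union_of_inc exI[of _ \<top>] *)
  then show "Min_primes \<subseteq> topspace ?X" by (rule openin_subset)
qed

end

theory Submission
  imports Defs
begin

text \<open>
  By \<open>pure_lfilter_iff\<close>, a filter is pure when the set of primes above it is stable under passing
  to smaller primes. A pure filter that lies below a prime \<open>p\<close> therefore lies below every minimal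
  prime inside \<open>p\<close>, and this is the link between the two spaces.

  If every minimal prime is pure, then two minimal primes inside one prime contain each other, so
  they coincide. Hence the equality \<open>Spp = Min_primes\<close> alone already gives the property \<open>mp\<close>.

  Conversely, suppose \<open>mp\<close>. Minimal primes are then pure, and, being prime, they are purely-prime.
  The coannihilators \<open>perp a\<close> are pure as well: prime separation yields, for each prime
  \<open>p \<supseteq> perp a\<close>, a prime \<open>q \<subseteq> p\<close> that omits \<open>a\<close> (\<open>prime_below_omitting\<close>), so the only minimal
  prime inside \<open>p\<close> omits \<open>a\<close> too. Two facts then do the rest.

  \<^item> For a minimal prime \<open>m\<close> one has \<open>a \<in> m\<close> iff \<open>perp a\<close> is not contained in \<open>m\<close>. So the basic open
    set of \<open>Min_d\<close> given by \<open>a\<close> is the open set of the pure spectrum given by the pure filter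
    \<open>perp a\<close>.
  \<^item> A pure filter \<open>F\<close> not contained in a prime \<open>m\<close> is comaximal with it: \<open>x * y = \<bottom>\<close> for some
    \<open>x \<in> F\<close>, \<open>y \<in> m\<close> (\<open>pure_lfilter_comaximal\<close>). Every proper filter containing \<open>y\<close> then fails to
    contain \<open>F\<close>, so the open sets of the pure spectrum are unions of basic open sets of \<open>Min_d\<close>.

  The second fact also shows that \<open>Min_d\<close> is Hausdorff, in the algebraic form that distinct minimal
  primes contain \<open>x\<close> and \<open>y\<close> with \<open>x * y = \<bottom>\<close>, whence \<open>perp x \<inter> perp y = {\<top>}\<close>. A purely-prime
  filter \<open>P\<close> thus contains \<open>perp x\<close> or \<open>perp y\<close> and cannot lie below both of these minimal primes.
  So just one minimal prime lies above \<open>P\<close>; since \<open>P\<close> is the intersection of the primes above it,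
  it equals that minimal prime.
\<close>

section \<open>Prime filters and comaximality\<close>

text \<open>
  A filter maximal among those disjoint from \<open>I\<close> is prime. If it contained \<open>x \<squnion> y\<close> but neither
  \<open>x\<close> nor \<open>y\<close>, then the strictly larger filter \<open>{z. z \<squnion> y \<in> M}\<close> would meet \<open>I\<close> in some \<open>s\<close>, and
  then \<open>{z. z \<squnion> s \<in> M}\<close> would meet it in some \<open>t\<close>, so that \<open>t \<squnion> s\<close> would lie in both \<open>M\<close> and \<open>I\<close>.
\<close>

lemma prime_lfilter_separation_ideal:
  fixes F I :: "'a::residuated_lattice set"
  assumes F: "lfilter F" and disj: "F \<inter> I = {}" and I_ne: "I \<noteq> {}"
    and I_sup: "\<And>x y. x \<in> I \<Longrightarrow> y \<in> I \<Longrightarrow> x \<squnion> y \<in> I"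
  obtains P where "prime_lfilter P" "F \<subseteq> P" "P \<inter> I = {}"
proof -
  let ?A = "{G. lfilter G \<and> F \<subseteq> G \<and> G \<inter> I = {}}"
  have "\<exists>M\<in>?A. \<forall>X\<in>?A. M \<subseteq> X \<longrightarrow> X = M"
  proof (rule subset_Zorn_nonempty)
    show "?A \<noteq> {}" using F disj by blast
  next
    fix C assume C: "C \<noteq> {}" "subset.chain ?A C"
    then have CA: "C \<subseteq> ?A" and lin: "\<And>X Y. X \<in> C \<Longrightarrow> Y \<in> C \<Longrightarrow> X \<subseteq> Y \<or> Y \<subseteq> X"
      by (auto simp: subset_chain_def)
    obtain X0 where X0: "X0 \<in> C" using C by blast
    have "lfilter (\<Union>C)"
    proof (rule lfilterI)
      show "\<top> \<in> \<Union>C" using X0 CA lfilter_top by blast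
    next
      fix u v assume "u \<in> \<Union>C" "v \<in> \<Union>C"
      then obtain X Y where "X \<in> C" "Y \<in> C" "u \<in> X" "v \<in> Y" by blast
      then obtain Z where "Z \<in> C" "u \<in> Z" "v \<in> Z" using lin by blast
      then show "u * v \<in> \<Union>C" using CA lfilter_mult by blast
    next
      fix u v assume "u \<in> \<Union>C" "u \<le> v"
      then show "v \<in> \<Union>C" using CA lfilter_up by blast
    qed
    then show "\<Union>C \<in> ?A" using CA X0 by blast
  qed
  then obtain M where "M \<in> ?A" and M_max: "\<forall>X\<in>?A. M \<subseteq> X \<longrightarrow> X = M" ..
  then have M: "lfilter M" "F \<subseteq> M" "M \<inter> I = {}" by simp_all
  have meets: "\<exists>s\<in>I. s \<squnion> v \<in> M" if "u \<squnion> v \<in> M" "u \<notin> M" for u v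
  proof -
    let ?Q = "{z. \<forall>w\<in>{v}. z \<squnion> w \<in> M}"
    have "lfilter ?Q" by (rule lfilter_quotient[OF M(1)])
    moreover have "M \<subseteq> ?Q" using M(1) by (auto simp: lfilter_def)
    moreover have "?Q \<noteq> M" using that by auto
    moreover have "F \<subseteq> ?Q" using M(2) \<open>M \<subseteq> ?Q\<close> by (rule subset_trans)
    ultimately have "?Q \<inter> I \<noteq> {}" using bspec[OF M_max, of ?Q] by auto
    then show ?thesis by auto
  qed
  have "x \<in> M \<or> y \<in> M" if xy: "x \<squnion> y \<in> M" for x y
  proof (rule ccontr)
    assume no: "\<not> (x \<in> M \<or> y \<in> M)"
    obtain s where s: "s \<in> I" "s \<squnion> y \<in> M" using meets[OF xy] no by blast
    then have "y \<squnion> s \<in> M" by (simp add: sup.commute)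
    then obtain t where "t \<in> I" "t \<squnion> s \<in> M" using meets no by blast
    then show False using I_sup[of t s] s(1) M(3) by blast
  qed
  moreover have "M \<noteq> UNIV" using M(3) I_ne by blast
  ultimately have "prime_lfilter M" using M(1) by (simp add: prime_lfilter_iff)
  then show ?thesis using M(2,3) by (rule that)
qed

lemma prime_lfilterD:
  assumes "prime_lfilter P"
  shows "lfilter P" and "P \<noteq> UNIV"
  using assms unfolding prime_lfilter_iff by blast+

lemma bot_notin_prime_lfilter:
  assumes P: "prime_lfilter P"
  shows "\<bottom> \<notin> P"
proof
  assume "\<bottom> \<in> P"
  then have "x \<in> P" for x using lfilter_up[OF prime_lfilterD(1)[OF P]] bot_least by blast
  then show False using prime_lfilterD(2)[OF P] by blast
qed

lemma Min_primesD:
  assumes "m \<in> Min_primes"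
  shows "prime_lfilter m" and "\<And>q. prime_lfilter q \<Longrightarrow> q \<subseteq> m \<Longrightarrow> q = m"
  using assms unfolding Min_primes_def by blast+

text \<open>The complement of the intersection of a chain of primes is a union of complements, so the
  maximal principle for unions of chains applies to the complements.\<close>

lemma prime_lfilter_contains_minimal:
  fixes P :: "'a::residuated_lattice set"
  assumes P: "prime_lfilter P"
  obtains m where "m \<in> Min_primes" "m \<subseteq> P"
proof -
  let ?A = "{X. prime_lfilter (- X) \<and> - X \<subseteq> P}"
  have "\<exists>M\<in>?A. \<forall>X\<in>?A. M \<subseteq> X \<longrightarrow> X = M"
  proof (rule subset_Zorn_nonempty)
    have "- P \<in> ?A" using P by simp
    then show "?A \<noteq> {}" by blast
  next
    fix C assume C: "C \<noteq> {}" "subset.chain ?A C"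
    then have CA: "C \<subseteq> ?A" and lin: "\<And>X Y. X \<in> C \<Longrightarrow> Y \<in> C \<Longrightarrow> X \<subseteq> Y \<or> Y \<subseteq> X"
      by (auto simp: subset_chain_def)
    obtain X0 where X0: "X0 \<in> C" using C by blast
    then have sub: "- \<Union>C \<subseteq> P" using CA by blast
    have eq: "- \<Union>C = \<Inter>(uminus ` C)" by blast
    have fil: "lfilter (- \<Union>C)"
      unfolding eq using CA by (intro lfilter_Inter) (auto intro: prime_lfilterD)
    have "x \<in> - \<Union>C \<or> y \<in> - \<Union>C" if xy: "x \<squnion> y \<in> - \<Union>C" for x y
    proof (rule ccontr)
      assume "\<not> (x \<in> - \<Union>C \<or> y \<in> - \<Union>C)"
      then obtain X Y where "X \<in> C" "Y \<in> C" "x \<in> X" "y \<in> Y" by blast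
      then obtain Z where Z: "Z \<in> C" "x \<in> Z" "y \<in> Z" using lin by blast
      then have "x \<squnion> y \<in> - Z" using xy by blast
      moreover have "prime_lfilter (- Z)" using CA Z by blast
      ultimately show False using Z unfolding prime_lfilter_iff by blast
    qed
    moreover have "- \<Union>C \<noteq> UNIV" using sub prime_lfilterD(2)[OF P] by blast
    ultimately have "prime_lfilter (- \<Union>C)" using fil by (simp add: prime_lfilter_iff)
    then show "\<Union>C \<in> ?A" using sub by blast
  qed
  then obtain M where "M \<in> ?A" and M_max: "\<forall>X\<in>?A. M \<subseteq> X \<longrightarrow> X = M" ..
  then have M: "prime_lfilter (- M)" "- M \<subseteq> P" by simp_all
  have "q = - M" if "prime_lfilter q" "q \<subseteq> - M" for q
  proof -
    have "- q \<in> ?A" "M \<subseteq> - q" using that M by auto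
    then have "- q = M" using M_max by blast
    then show ?thesis by blast
  qed
  then have "- M \<in> Min_primes" using M(1) by (simp add: Min_primes_def)
  then show ?thesis using that M(2) by blast
qed

text \<open>The products of elements of \<open>F\<close> and \<open>G\<close> generate the join of the two filters. A join without
  \<open>\<bottom>\<close> would extend to a prime.\<close>

lemma lfilter_comaximal:
  fixes F G :: "'a::residuated_lattice set"
  assumes F: "lfilter F" and G: "lfilter G"
    and no_prime: "\<And>p. prime_lfilter p \<Longrightarrow> F \<subseteq> p \<Longrightarrow> G \<subseteq> p \<Longrightarrow> False"
  obtains x y where "x \<in> F" "y \<in> G" "x * y = \<bottom>"
proof -
  let ?H = "{z. \<exists>x\<in>F. \<exists>y\<in>G. x * y \<le> z}"
  have H: "lfilter ?H"
  proof (rule lfilterI)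
    show "\<top> \<in> ?H" using lfilter_top[OF F] lfilter_top[OF G] by auto
  next
    fix z z' assume "z \<in> ?H" "z' \<in> ?H"
    then obtain x y x' y' where *: "x \<in> F" "y \<in> G" "x' \<in> F" "y' \<in> G"
      and le: "x * y \<le> z" "x' * y' \<le> z'" by blast
    have "(x * x') * (y * y') = (x * y) * (x' * y')" by (simp add: ac_simps)
    also have "\<dots> \<le> z * (x' * y')" by (rule mult_left_mono_rl[OF le(1)])
    also have "\<dots> \<le> z * z'" using mult_left_mono_rl[OF le(2), of z] by (simp add: mult.commute)
    finally have "(x * x') * (y * y') \<le> z * z'" .
    then show "z * z' \<in> ?H" using * lfilter_mult[OF F] lfilter_mult[OF G] by blast
  next
    fix z z' assume "z \<in> ?H" "z \<le> z'"
    then show "z' \<in> ?H" by (auto intro: order_trans)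
  qed
  have sub: "F \<subseteq> ?H" "G \<subseteq> ?H"
    using lfilter_top[OF F] lfilter_top[OF G] mult_le_left_rl mult_le_right_rl by blast+
  have "\<bottom> \<in> ?H"
  proof (rule ccontr)
    assume "\<bottom> \<notin> ?H"
    with H obtain p where p: "prime_lfilter p" "?H \<subseteq> p" by (rule prime_lfilter_separation)
    show False using sub[THEN subset_trans, OF p(2)] by (rule no_prime[OF p(1)])
  qed
  then show ?thesis using that by (auto simp: bot_unique)
qed

text \<open>Any prime above both \<open>F\<close> and \<open>m\<close> would force \<open>F \<subseteq> m\<close> by purity.\<close>

lemma pure_lfilter_comaximal:
  assumes F: "pure_lfilter F" and m: "prime_lfilter m" and nsub: "\<not> F \<subseteq> m"
  obtains x y where "x \<in> F" "y \<in> m" "x * y = \<bottom>"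
proof (rule lfilter_comaximal)
  show "lfilter F" "lfilter m" using F prime_lfilterD(1)[OF m] by (simp_all add: pure_lfilter_def)
  show False if "prime_lfilter p" "F \<subseteq> p" "m \<subseteq> p" for p
    using pure_lfilter_subset[OF F that(1) m that(2,3)] nsub by blast
qed (rule that)


section \<open>Coannihilators\<close>

definition perp :: "'a::residuated_lattice \<Rightarrow> 'a set" where
  "perp a = {b. b \<squnion> a = \<top>}"

lemma lfilter_perp: "lfilter (perp a)"
  using lfilter_quotient[OF lfilter_top_singleton, of "{a}"] by (simp add: perp_def)

lemma perp_subset_prime:
  assumes "prime_lfilter q" "a \<notin> q"
  shows "perp a \<subseteq> q"
proof
  fix b assume "b \<in> perp a"
  then have "b \<squnion> a \<in> q" using lfilter_top[OF prime_lfilterD(1)[OF assms(1)]] by (simp add: perp_def)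
  then show "b \<in> q" using assms unfolding prime_lfilter_iff by blast
qed

text \<open>Distributing, \<open>(x \<squnion> z) * (y \<squnion> z)\<close> lies below \<open>x * y \<squnion> z\<close>, which here is \<open>z\<close>.\<close>

lemma perp_Int_trivial:
  assumes "x * y = \<bottom>"
  shows "perp x \<inter> perp y = {\<top>}"
proof -
  have "z = \<top>" if "z \<squnion> x = \<top>" "z \<squnion> y = \<top>" for z
  proof -
    have "\<top> * \<top> \<le> x * y \<squnion> z"
      using sup_mult_sup_le[of x z y] that by (simp add: sup.commute)
    moreover have "\<top> * \<top> = (\<top> :: 'a)" using mult_1_left[of "1 :: 'a"] by (simp add: one_eq_top)
    ultimately show ?thesis using assms by (simp add: top_unique)
  qed
  then show ?thesis by (auto simp: perp_def)
qed

text \<open>The join-closed set to be avoided is the ideal generated by \<open>a\<close> and the complement of \<open>p\<close>; it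
  omits \<open>\<top>\<close> exactly because \<open>perp a \<subseteq> p\<close>.\<close>

lemma prime_below_omitting:
  assumes p: "prime_lfilter p" and sub: "perp a \<subseteq> p"
  obtains q where "prime_lfilter q" "q \<subseteq> p" "a \<notin> q"
proof -
  let ?I = "{z. \<exists>y. y \<notin> p \<and> z \<le> a \<squnion> y}"
  obtain q where q: "prime_lfilter q" "q \<inter> ?I = {}"
  proof (rule prime_lfilter_separation_ideal[OF lfilter_top_singleton, of ?I])
    show "{\<top>} \<inter> ?I = {}" using sub by (auto simp: perp_def top_unique sup.commute)
    have "a \<in> ?I" using bot_notin_prime_lfilter[OF p] by auto
    then show "?I \<noteq> {}" by blast
  next
    fix u v assume "u \<in> ?I" "v \<in> ?I"
    then obtain y z where yz: "y \<notin> p" "u \<le> a \<squnion> y" "z \<notin> p" "v \<le> a \<squnion> z" by blast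
    have "y \<squnion> z \<notin> p" using p yz unfolding prime_lfilter_iff by blast
    moreover have "u \<squnion> v \<le> a \<squnion> (y \<squnion> z)"
      using sup_mono[OF yz(2,4)] by (simp add: ac_simps)
    ultimately show "u \<squnion> v \<in> ?I" by blast
  qed
  have "a \<in> ?I" using bot_notin_prime_lfilter[OF p] by auto
  moreover have "- p \<subseteq> ?I" using sup_ge2 by blast
  ultimately show ?thesis using that q by blast
qed

lemma Min_primes_mem_iff_perp:
  assumes m: "m \<in> Min_primes"
  shows "a \<in> m \<longleftrightarrow> \<not> perp a \<subseteq> m"
proof
  have prime: "prime_lfilter m" by (rule Min_primesD(1)[OF m])
  show "\<not> perp a \<subseteq> m" if "a \<in> m"
  proof
    assume "perp a \<subseteq> m"
    with prime obtain q where q: "prime_lfilter q" "q \<subseteq> m" "a \<notin> q"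
      by (rule prime_below_omitting)
    have "q = m" by (rule Min_primesD(2)[OF m q(1,2)])
    then show False using q(3) that by simp
  qed
  show "a \<in> m" if "\<not> perp a \<subseteq> m"
    using that perp_subset_prime[OF prime, of a] by (rule contrapos_np)
qed


section \<open>Purity under the unique minimal prime condition\<close>

lemma mp_minimal_subset:
  fixes p q m :: "'a::residuated_lattice set"
  assumes mp: "mp TYPE('a)" and "prime_lfilter p" "prime_lfilter q"
    and "m \<in> Min_primes" "m \<subseteq> p" "q \<subseteq> p"
  shows "m \<subseteq> q"
proof -
  obtain m' where m': "m' \<in> Min_primes" "m' \<subseteq> q"
    using prime_lfilter_contains_minimal[OF assms(3)] .
  have "\<exists>!k. k \<in> Min_primes \<and> k \<subseteq> p" using mp assms(2) by (simp add: mp_def)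
  moreover have "m' \<subseteq> p" using m'(2) assms(6) by (rule subset_trans)
  ultimately have "m' = m" using m'(1) assms(4,5) by (metis (no_types))
  show ?thesis using m'(2) unfolding \<open>m' = m\<close> .
qed

lemma mp_pure_minimal:
  fixes m :: "'a::residuated_lattice set"
  assumes "mp TYPE('a)" "m \<in> Min_primes"
  shows "pure_lfilter m"
  unfolding pure_lfilter_iff
proof (intro conjI allI impI)
  show "lfilter m" using assms(2) by (rule Min_primes_lfilter)
  show "m \<subseteq> q" if "prime_lfilter p" "prime_lfilter q" "m \<subseteq> p" "q \<subseteq> p" for p q
    by (rule mp_minimal_subset[OF assms(1) that(1,2) assms(2) that(3,4)])
qed

text \<open>The prime inside \<open>p\<close> that omits \<open>a\<close> contains the minimal prime \<open>m\<close> of \<open>p\<close>; so \<open>a \<notin> m\<close>, and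
  \<open>perp a\<close> lies in \<open>m\<close>, hence in every prime inside \<open>p\<close>.\<close>

lemma mp_pure_perp:
  fixes a :: "'a::residuated_lattice"
  assumes mp: "mp TYPE('a)"
  shows "pure_lfilter (perp a)"
  unfolding pure_lfilter_iff
proof (intro conjI allI impI)
  show "lfilter (perp a)" by (rule lfilter_perp)
next
  fix p q :: "'a set"
  assume p: "prime_lfilter p" and q: "prime_lfilter q" and sub: "perp a \<subseteq> p" "q \<subseteq> p"
  obtain r where r: "prime_lfilter r" "r \<subseteq> p" "a \<notin> r"
    using prime_below_omitting[OF p sub(1)] .
  obtain m where m: "m \<in> Min_primes" "m \<subseteq> p"
    using prime_lfilter_contains_minimal[OF p] .
  have "a \<notin> m" using mp_minimal_subset[OF mp p r(1) m r(2)] r(3) by blast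
  then have "perp a \<subseteq> m" using Min_primes_mem_iff_perp[OF m(1)] by blast
  also have "m \<subseteq> q" by (rule mp_minimal_subset[OF mp p q m sub(2)])
  finally show "perp a \<subseteq> q" .
qed

text \<open>
  In a Hausdorff space an irreducible closed set has at most one point. Here the closed set consists
  of the minimal primes above \<open>P\<close>; the sets of minimal primes containing \<open>x\<close> and \<open>y\<close> separate \<open>m\<close>
  from \<open>n\<close>, and the irreducibility of \<open>P\<close> is applied to their pure filters \<open>perp x\<close> and \<open>perp y\<close>.
\<close>

lemma mp_Spp_below_unique:
  fixes P m n :: "'a::residuated_lattice set"
  assumes mp: "mp TYPE('a)" and P: "P \<in> Spp"
    and m: "m \<in> Min_primes" "P \<subseteq> m" and n: "n \<in> Min_primes" "P \<subseteq> n"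
  shows "m = n"
proof (rule ccontr)
  assume "m \<noteq> n"
  have primes: "prime_lfilter m" "prime_lfilter n" using m n by (auto dest: Min_primesD(1))
  have "\<not> m \<subseteq> n" using Min_primesD(2)[OF n(1) primes(1)] \<open>m \<noteq> n\<close> by blast
  then obtain x y where xy: "x \<in> m" "y \<in> n" "x * y = \<bottom>"
    using pure_lfilter_comaximal[OF mp_pure_minimal[OF mp m(1)] primes(2)] by blast
  have "perp x \<inter> perp y \<subseteq> P"
    using perp_Int_trivial[OF xy(3)] lfilter_top[OF Spp_lfilter[OF P]] by simp
  then have "perp x \<subseteq> P \<or> perp y \<subseteq> P"
    using P mp_pure_perp[OF mp] unfolding Spp_def by blast
  then show False
    using Min_primes_mem_iff_perp[OF m(1), of x] Min_primes_mem_iff_perp[OF n(1), of y] xy m n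
    by blast
qed

lemma mp_Spp_eq_Min_primes:
  assumes mp: "mp TYPE('a::residuated_lattice)"
  shows "(Spp :: 'a set set) = Min_primes"
proof (rule subset_antisym)
  show "(Min_primes :: 'a set set) \<subseteq> Spp"
  proof
    fix m :: "'a set" assume m: "m \<in> Min_primes"
    then have prime: "prime_lfilter m" by (rule Min_primesD(1))
    have "F \<subseteq> m \<or> G \<subseteq> m" if "pure_lfilter F" "pure_lfilter G" "F \<inter> G \<subseteq> m" for F G
      using that prime_lfilter_Int_subset[OF prime] by (simp add: pure_lfilter_def)
    then show "m \<in> Spp"
      using mp_pure_minimal[OF mp m] prime_lfilterD(2)[OF prime] by (simp add: Spp_def)
  qed
next
  show "(Spp :: 'a set set) \<subseteq> Min_primes"
  proof
    fix P :: "'a set" assume P: "P \<in> Spp"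
    then have pure: "pure_lfilter P" and proper: "P \<noteq> UNIV" by (auto simp: Spp_def)
    have min_above: "\<exists>m. m \<in> Min_primes \<and> P \<subseteq> m \<and> m \<subseteq> p"
      if p: "prime_lfilter p" "P \<subseteq> p" for p
    proof -
      obtain m where m: "m \<in> Min_primes" "m \<subseteq> p"
        using prime_lfilter_contains_minimal[OF p(1)] .
      then have "P \<subseteq> m"
        by (intro pure_lfilter_subset[OF pure p(1) Min_primesD(1) p(2)])
      then show ?thesis using m by blast
    qed
    obtain z where "z \<notin> P" using proper by blast
    then obtain p where "prime_lfilter p" "P \<subseteq> p"
      using prime_lfilter_separation[OF Spp_lfilter[OF P]] by blast
    then obtain m where m: "m \<in> Min_primes" "P \<subseteq> m" using min_above by blast
    \<comment> \<open>\<open>P\<close> is the intersection of the primes above it, and each of these contains \<open>m\<close>.\<close>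
    have "m \<subseteq> P"
    proof (rule ccontr)
      assume "\<not> m \<subseteq> P"
      then obtain a where a: "a \<in> m" "a \<notin> P" by blast
      obtain p where p: "prime_lfilter p" "P \<subseteq> p" "a \<notin> p"
        using prime_lfilter_separation[OF Spp_lfilter[OF P] a(2)] .
      obtain n where n: "n \<in> Min_primes" "P \<subseteq> n" "n \<subseteq> p" using min_above[OF p(1,2)] by blast
      have "m = n" by (rule mp_Spp_below_unique[OF mp P m n(1,2)])
      then show False using a(1) n(3) p(3) by blast
    qed
    then show "P \<in> Min_primes" using m by auto
  qed
qed

text \<open>Both comparisons of open sets rest on testing at minimal primes: \<open>perp x\<close> represents the
  basic open set of \<open>x\<close>, and comaximality finds a basic neighbourhood inside \<open>d_p F\<close>.\<close>

lemma mp_topologies_eq: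
  assumes mp: "mp TYPE('a::residuated_lattice)"
  shows "(pure_spectrum :: 'a set topology) = Min_d"
  unfolding topology_eq
proof (intro allI iffI)
  note Spp_eq = mp_Spp_eq_Min_primes[OF mp]
  {
    fix U :: "'a set set" assume "openin pure_spectrum U"
    then obtain F where F: "pure_lfilter F" "U = d_p F" unfolding openin_pure_spectrum by blast
    have "\<exists>T. openin Min_d T \<and> m \<in> T \<and> T \<subseteq> U" if mU: "m \<in> U" for m
    proof -
      have m: "m \<in> Min_primes" "\<not> F \<subseteq> m" using mU F(2) Spp_eq by (auto simp: d_p_def)
      have prime: "prime_lfilter m" by (rule Min_primesD(1)[OF m(1)])
      obtain x y where xy: "x \<in> F" "y \<in> m" "x * y = \<bottom>"
        by (rule pure_lfilter_comaximal[OF F(1) prime m(2)])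
      have "\<not> F \<subseteq> n" if n: "n \<in> Min_primes" "y \<in> n" for n
      proof
        assume "F \<subseteq> n"
        then have "\<bottom> \<in> n" using lfilter_mult[OF Min_primes_lfilter[OF n(1)], of x y] xy n by auto
        then show False using bot_notin_prime_lfilter[OF Min_primesD(1)[OF n(1)]] by simp
      qed
      then have "{n \<in> Min_primes. y \<in> n} \<subseteq> U" using F(2) Spp_eq by (auto simp: d_p_def)
      moreover have "openin Min_d {n \<in> Min_primes. y \<in> n}"
        unfolding openin_Min_d by (intro arbitrary_union_of_inc exI[of _ y] refl)
      ultimately show ?thesis using m xy(2) by blast
    qed
    then show "openin Min_d U" using openin_subopen[of Min_d U] by blast
  next
    fix U :: "'a set set" assume "openin Min_d U"
    then obtain K where K: "K \<subseteq> Collect (\<lambda>U. \<exists>x. U = {m \<in> Min_primes. x \<in> m})" "\<Union>K = U"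
      unfolding openin_Min_d union_of_def by blast
    have "openin pure_spectrum V" if V: "V \<in> K" for V
    proof -
      obtain x where "V = {m \<in> Min_primes. x \<in> m}" using K(1) V by blast
      then have "V = d_p (perp x)"
        using Min_primes_mem_iff_perp[of _ x] Spp_eq by (auto simp: d_p_def)
      then show ?thesis unfolding openin_pure_spectrum using mp_pure_perp[OF mp] by blast
    qed
    then show "openin pure_spectrum U" using K(2) by blast
  }
qed

text \<open>If all minimal primes are pure, two of them inside one prime contain each other.\<close>

lemma mp_if_minimal_pure:
  assumes pure: "\<And>m :: 'a::residuated_lattice set. m \<in> Min_primes \<Longrightarrow> pure_lfilter m"
  shows "mp TYPE('a)"
  unfolding mp_def
proof (intro allI impI)
  fix P :: "'a set" assume P: "prime_lfilter P"
  have sub: "m \<subseteq> n" if "m \<in> Min_primes" "n \<in> Min_primes" "m \<subseteq> P" "n \<subseteq> P" for m n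
    by (rule pure_lfilter_subset[OF pure[OF that(1)] P Min_primesD(1)[OF that(2)] that(3,4)])
  obtain m where "m \<in> Min_primes" "m \<subseteq> P" using prime_lfilter_contains_minimal[OF P] .
  then show "\<exists>!m. m \<in> Min_primes \<and> m \<subseteq> P" using sub by (intro ex1I[of _ m]) blast+
qed

theorem theorem4p16:
  shows "mp TYPE('a::residuated_lattice) \<longleftrightarrow>
    (Spp :: 'a set set) = Min_primes \<and>
    homeomorphic_map (pure_spectrum :: 'a set topology) Min_d id"
proof
  assume mp: "mp TYPE('a)"
  then show "(Spp :: 'a set set) = Min_primes \<and>
    homeomorphic_map (pure_spectrum :: 'a set topology) Min_d id"
    using mp_Spp_eq_Min_primes[OF mp] mp_topologies_eq[OF mp] by simp
next
  assume "(Spp :: 'a set set) = Min_primes \<and>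
    homeomorphic_map (pure_spectrum :: 'a set topology) Min_d id"
  then have "pure_lfilter m" if "m \<in> Min_primes" for m :: "'a set"
    using that by (auto simp: Spp_def)
  then show "mp TYPE('a)" by (rule mp_if_minimal_pure)
qed

end
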